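(* Let $\theta=(k_r)$ be a lacunary sequence with $\liminf_{r} q_r>1$, let $E\subset\mathbb{R}$ be a lacunary statistically ward compact set, and let $f:E\to\mathbb{R}$ be lacunary statistically ward continuous on $E$ (both notions with respect to $\theta$). Then $f$ is uniformly continuous on $E$.
   Context: A lacunary sequence is an increasing sequence $\theta=(k_r)_{r\ge 0}$ of integers with $k_0=0$ and $h_r:=k_r-k_{r-1}\to\infty$ as $r\to\infty$. Put $I_r=(k_{r-1},k_r]$ (the integers in it) and $q_r=k_r/k_{r-1}$ (for $r\ge 2$). A real sequence $(x_k)_{k\ge1}$ is lacunary statistically convergent to $L\in\mathbb{R}$ (with respect to $\theta$) if for every $\varepsilon>0$, $\lim_{r\to\infty}\frac{1}{h_r}|\{k\in I_r: |x_k-L|\ge\varepsilon\}|=0$. A real sequence $(\alpha_k)_{k\ge 1}$ is lacunary statistically quasi-Cauchy if $(\Delta\alpha_k)$, where $\Delta\alpha_k=\alpha_{k+1}-\alpha_k$, is lacunary statistically convergent to $0$. A set $E\subset\mathbb{R}$ is lacunary statistically ward compact if every sequence of points in $E$ has a lacunary statistically quasi-Cauchy subsequence. A function $f:E\to\mathbb{R}$ is lacunary statistically ward continuous on $E$ if $(f(\alpha_k))$ is lacunary statistically quasi-Cauchy whenever $(\alpha_k)$ is a lacunary statistically quasi-Cauchy sequence of points in $E$. All these notions are with respect to the same fixed $\theta$. *)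

theory Defs
  imports Complex_Main "HOL-Library.Extended_Real"
begin

text \<open>
  Real sequences indexed by the integers k \<ge> 1 are functions on nat whose value at 0 is
  never inspected: below, the blocks of a lacunary sequence (for r \<ge> 1) contain only positive
  indices, and limits in r ignore the junk values that truncated subtraction gives at r = 0.
\<close>

definition lacunary_h :: "(nat \<Rightarrow> nat) \<Rightarrow> nat \<Rightarrow> nat" where
  "lacunary_h \<theta> r = \<theta> r - \<theta> (r - 1)"

definition lacunary_I :: "(nat \<Rightarrow> nat) \<Rightarrow> nat \<Rightarrow> nat set" where
  "lacunary_I \<theta> r = {\<theta> (r - 1)<..\<theta> r}"

definition lacunary_q :: "(nat \<Rightarrow> nat) \<Rightarrow> nat \<Rightarrow> real" where
  "lacunary_q \<theta> r = real (\<theta> r) / real (\<theta> (r - 1))"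

definition lacunary :: "(nat \<Rightarrow> nat) \<Rightarrow> bool" where
  "lacunary \<theta> \<longleftrightarrow>
     \<theta> 0 = 0 \<and> strict_mono \<theta> \<and> filterlim (lacunary_h \<theta>) at_top sequentially"

definition lac_stat_convergent :: "(nat \<Rightarrow> nat) \<Rightarrow> (nat \<Rightarrow> real) \<Rightarrow> real \<Rightarrow> bool" where
  "lac_stat_convergent \<theta> x L \<longleftrightarrow>
     (\<forall>\<epsilon>>0. (\<lambda>r. 1 / real (lacunary_h \<theta> r)
                 * real (card {k \<in> lacunary_I \<theta> r. \<bar>x k - L\<bar> \<ge> \<epsilon>})) \<longlonglongrightarrow> 0)"

definition lac_stat_quasi_Cauchy :: "(nat \<Rightarrow> nat) \<Rightarrow> (nat \<Rightarrow> real) \<Rightarrow> bool" where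
  "lac_stat_quasi_Cauchy \<theta> \<alpha> \<longleftrightarrow> lac_stat_convergent \<theta> (\<lambda>k. \<alpha> (k + 1) - \<alpha> k) 0"

text \<open>
  A strictly increasing s on nat maps positive indices to positive indices, and every strictly
  increasing map of the positive integers extends to such an s by s 0 = 0; so the s below
  are exactly the index maps of subsequences of a sequence indexed from 1.
\<close>

definition lac_stat_ward_compact :: "(nat \<Rightarrow> nat) \<Rightarrow> real set \<Rightarrow> bool" where
  "lac_stat_ward_compact \<theta> E \<longleftrightarrow>
     (\<forall>x. (\<forall>n\<ge>1. x n \<in> E) \<longrightarrow>
        (\<exists>s :: nat \<Rightarrow> nat. strict_mono s \<and> lac_stat_quasi_Cauchy \<theta> (x \<circ> s)))"

definition lac_stat_ward_continuous_on ::
    "(nat \<Rightarrow> nat) \<Rightarrow> real set \<Rightarrow> (real \<Rightarrow> real) \<Rightarrow> bool" where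
  "lac_stat_ward_continuous_on \<theta> E f \<longleftrightarrow>
     (\<forall>\<alpha>. (\<forall>n\<ge>1. \<alpha> n \<in> E) \<longrightarrow> lac_stat_quasi_Cauchy \<theta> \<alpha> \<longrightarrow>
        lac_stat_quasi_Cauchy \<theta> (\<lambda>n. f (\<alpha> n)))"

end

theory Submission imports Defs begin

text \<open>
  A sequence in \<open>E\<close> whose absolute values grow by at least 1 at each step has no
  quasi-Cauchy subsequence, so \<open>E\<close> is bounded. If \<open>f\<close> were not uniformly continuous,
  Bolzano-Weierstrass would give sequences \<open>X\<close>, \<open>Y\<close> in \<open>E\<close> with a common limit whose images
  stay \<open>e\<close> apart. The interleaving of \<open>X\<close> and \<open>Y\<close> converges, hence is quasi-Cauchy, but its
  image jumps by \<open>e\<close> at every even index, that is, at about half of the indices of each block.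
\<close>

lemma card_even_greaterThanAtMost:
  fixes a b :: nat
  shows "(b - a) div 2 \<le> card {k \<in> {a<..b}. even k}"
proof -
  \<comment> \<open>\<open>2 * (a div 2 + 1)\<close> is the least even number above
    \<open>a\<close>, whatever the parity of \<open>a\<close>.\<close>
  have "(\<lambda>j. 2 * (a div 2 + 1 + j)) ` {..<(b - a) div 2} \<subseteq> {k \<in> {a<..b}. even k}"
    by auto
  moreover have "inj_on (\<lambda>j. 2 * (a div 2 + 1 + j)) {..<(b - a) div 2}"
    by (auto simp: inj_on_def)
  ultimately show ?thesis
    using card_inj_on_le[of _ "{..<(b - a) div 2}"] by fastforce
qed

text \<open>Even indices make up at least half of each block, rounded down, so the proportion of far
  indices cannot fall below 1/4 in long blocks. This refutes convergence both for unbounded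
  \<open>E\<close> and for the image of the interleaving.\<close>

lemma not_lac_stat_convergent_if_even_far:
  assumes "lacunary \<theta>" and "\<epsilon> > 0" and far: "\<And>k. even k \<Longrightarrow> \<bar>x k - L\<bar> \<ge> \<epsilon>"
  shows "\<not> lac_stat_convergent \<theta> x L"
proof
  assume "lac_stat_convergent \<theta> x L"
  then have "(\<lambda>r. 1 / real (lacunary_h \<theta> r)
      * real (card {k \<in> lacunary_I \<theta> r. \<bar>x k - L\<bar> \<ge> \<epsilon>})) \<longlonglongrightarrow> 0"
    using \<open>\<epsilon> > 0\<close> by (auto simp: lac_stat_convergent_def)
  then have small: "\<forall>\<^sub>F r in sequentially. 1 / real (lacunary_h \<theta> r)
      * real (card {k \<in> lacunary_I \<theta> r. \<bar>x k - L\<bar> \<ge> \<epsilon>}) < 1/4"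
    by (rule order_tendstoD) simp
  \<comment> \<open>From length 2 on, half the length rounded down is still at least a quarter of
    it; a block of length 1 may contain no even index.\<close>
  have "\<forall>\<^sub>F r in sequentially. lacunary_h \<theta> r \<ge> 2"
    using assms(1) by (auto simp: lacunary_def filterlim_at_top)
  with small have "\<forall>\<^sub>F r in sequentially. False"
  proof eventually_elim
    case (elim r)
    let ?h = "lacunary_h \<theta> r" and ?C = "{k \<in> lacunary_I \<theta> r. \<bar>x k - L\<bar> \<ge> \<epsilon>}"
    have "?h div 2 \<le> card {k \<in> lacunary_I \<theta> r. even k}"
      unfolding lacunary_h_def lacunary_I_def by (rule card_even_greaterThanAtMost)
    also have "\<dots> \<le> card ?C"
      using far by (intro card_mono) (auto simp: lacunary_I_def)
    finally have "?h \<le> 4 * card ?C"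
      using elim(2) by linarith
    then have "real ?h \<le> 4 * real (card ?C)"
      by linarith
    with elim show False
      by (simp add: field_simps)
  qed
  then show False
    by simp
qed

text \<open>The differences tend to 0, so only finitely many reach \<open>\<epsilon>\<close>, and
  late blocks miss those indices: the counted set is eventually empty.\<close>

lemma convergent_imp_lac_stat_quasi_Cauchy:
  assumes "lacunary \<theta>" and "\<alpha> \<longlonglongrightarrow> a"
  shows "lac_stat_quasi_Cauchy \<theta> \<alpha>"
  unfolding lac_stat_quasi_Cauchy_def lac_stat_convergent_def
proof (intro allI impI)
  fix \<epsilon> :: real
  assume "\<epsilon> > 0"
  have "(\<lambda>k. \<alpha> (k + 1) - \<alpha> k) \<longlonglongrightarrow> a - a"
    using assms(2) by (intro tendsto_diff LIMSEQ_ignore_initial_segment)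
  then obtain N where N: "\<And>k. k \<ge> N \<Longrightarrow> \<bar>\<alpha> (k + 1) - \<alpha> k\<bar> < \<epsilon>"
    using \<open>\<epsilon> > 0\<close> by (auto simp: LIMSEQ_iff)
  let ?C = "\<lambda>r. {k \<in> lacunary_I \<theta> r. \<epsilon> \<le> \<bar>\<alpha> (k + 1) - \<alpha> k - 0\<bar>}"
  show "(\<lambda>r. 1 / real (lacunary_h \<theta> r) * real (card (?C r))) \<longlonglongrightarrow> 0"
  proof (rule tendsto_eventually, rule eventually_sequentiallyI)
    fix r
    assume "r \<ge> Suc N"
    \<comment> \<open>A strictly increasing \<open>\<theta>\<close> satisfies
      \<open>r - 1 \<le> \<theta> (r - 1)\<close>, so block \<open>r\<close> lies beyond
      \<open>N\<close>.\<close>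
    then have "N \<le> \<theta> (r - 1)"
      using assms(1) strict_mono_imp_increasing[of \<theta> "r - 1"] by (simp add: lacunary_def)
    then have "\<bar>\<alpha> (k + 1) - \<alpha> k\<bar> < \<epsilon>" if "k \<in> lacunary_I \<theta> r" for k
      using that by (intro N) (simp add: lacunary_I_def)
    then have "?C r = {}"
      by (auto simp: not_le[symmetric])
    then show "1 / real (lacunary_h \<theta> r) * real (card (?C r)) = 0"
      by (simp only: card.empty of_nat_0 mult_zero_right)
  qed
qed

lemma lac_stat_ward_compact_imp_bounded:
  assumes "lacunary \<theta>" and "lac_stat_ward_compact \<theta> E"
  obtains B where "\<And>x. x \<in> E \<Longrightarrow> \<bar>x\<bar> \<le> B"
proof (rule ccontr)
  assume "\<not> thesis"
  with that have unb: "\<exists>y\<in>E. \<bar>y\<bar> > B" for B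
    by (meson not_le)
  have "\<exists>x. \<forall>n. x n \<in> E \<and> \<bar>x (Suc n)\<bar> > \<bar>x n\<bar> + 1"
    by (rule dependent_nat_choice) (use unb in blast)+
  then obtain x where xE: "\<And>n. x n \<in> E" and step: "\<And>n. \<bar>x n\<bar> + 1 < \<bar>x (Suc n)\<bar>"
    by blast
  \<comment> \<open>A subsequence may skip terms, so the gap is needed for all pairs of indices; the
    reverse triangle inequality then makes every jump of \<open>x \<circ> s\<close> at least
    1.\<close>
  have gap: "\<bar>x m\<bar> + 1 \<le> \<bar>x n\<bar>" if "m < n" for m n
    using that
  proof (induction n)
    case (Suc n)
    with step[of n] show ?case
      by (cases "m = n") auto
  qed simp
  obtain s :: "nat \<Rightarrow> nat" where "strict_mono s" and qC: "lac_stat_quasi_Cauchy \<theta> (x \<circ> s)"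
    using assms(2) xE unfolding lac_stat_ward_compact_def by blast
  have "\<bar>((x \<circ> s) (k + 1) - (x \<circ> s) k) - 0\<bar> \<ge> 1" for k
    using gap[of "s k" "s (k + 1)"] \<open>strict_mono s\<close> by (simp add: strict_mono_def)
  then have "\<not> lac_stat_convergent \<theta> (\<lambda>k. (x \<circ> s) (k + 1) - (x \<circ> s) k) 0"
    by (rule not_lac_stat_convergent_if_even_far[OF assms(1) zero_less_one])
  with qC show False
    unfolding lac_stat_quasi_Cauchy_def by contradiction
qed

lemma interleave_tendsto:
  fixes X Y :: "nat \<Rightarrow> real"
  assumes "X \<longlonglongrightarrow> a" and "Y \<longlonglongrightarrow> a"
  shows "(\<lambda>k. if even k then X (k div 2) else Y (k div 2)) \<longlonglongrightarrow> a"
proof -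
  have "filterlim (\<lambda>k::nat. k div 2) sequentially sequentially"
    unfolding filterlim_at_top
    by (metis (no_types, lifting) div_le_mono eventually_sequentiallyI
        nonzero_mult_div_cancel_left zero_neq_numeral)
  \<comment> \<open>Each branch need only converge along the indices of its parity, a finer filter
    than \<open>sequentially\<close>.\<close>
  from filterlim_compose[OF assms(1) this] filterlim_compose[OF assms(2) this]
  show ?thesis
    by (intro filterlim_If) (auto elim: filterlim_mono)
qed

theorem theorem3:
  fixes \<theta> :: "nat \<Rightarrow> nat" and E :: "real set" and f :: "real \<Rightarrow> real"
  assumes "lacunary \<theta>"
    and "liminf (\<lambda>r. ereal (lacunary_q \<theta> r)) > 1"
    and "lac_stat_ward_compact \<theta> E"
    and "lac_stat_ward_continuous_on \<theta> E f"
  shows "uniformly_continuous_on E f"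
proof (rule ccontr)
  assume "\<not> uniformly_continuous_on E f"
  then obtain e where "e > 0"
    and e: "\<And>d. d > 0 \<Longrightarrow> \<exists>x\<in>E. \<exists>y\<in>E. \<bar>x - y\<bar> < d \<and> e \<le> \<bar>f x - f y\<bar>"
    unfolding uniformly_continuous_on_def dist_real_def
    by (metis abs_minus_commute not_le)
  have "\<exists>x y. x \<in> E \<and> y \<in> E \<and> \<bar>x - y\<bar> < inverse (real (Suc n)) \<and> e \<le> \<bar>f x - f y\<bar>" for n
    using e[of "inverse (real (Suc n))"] by auto
  then obtain x y where xE: "\<And>n. x n \<in> E" and yE: "\<And>n. y n \<in> E"
    and close: "\<And>n. \<bar>x n - y n\<bar> < inverse (real (Suc n))"
    and apart: "\<And>n. e \<le> \<bar>f (x n) - f (y n)\<bar>"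
    by metis
  obtain B where "\<And>u. u \<in> E \<Longrightarrow> \<bar>u\<bar> \<le> B"
    using lac_stat_ward_compact_imp_bounded[OF assms(1,3)] by blast
  then have bdd: "Bseq (x \<circ> s)" for s :: "nat \<Rightarrow> nat"
    using xE by (intro BseqI'[of _ B]) auto
  \<comment> \<open>A bounded monotone subsequence converges; its limit \<open>a\<close> need not
    lie in \<open>E\<close>.\<close>
  obtain s :: "nat \<Rightarrow> nat" where "strict_mono s" and "monoseq (\<lambda>n. x (s n))"
    using seq_monosub by blast
  then obtain a where lim_x: "(x \<circ> s) \<longlonglongrightarrow> a"
    using Bseq_monoseq_convergent[OF bdd, of s] by (auto simp: comp_def convergent_def)
  have "(\<lambda>n. x n - y n) \<longlonglongrightarrow> 0"
    using close by (intro LIMSEQ_norm_0) (simp add: inverse_eq_divide)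
  from tendsto_diff[OF lim_x LIMSEQ_subseq_LIMSEQ[OF this \<open>strict_mono s\<close>]]
  have lim_y: "(y \<circ> s) \<longlonglongrightarrow> a"
    by (simp add: comp_def)
  define \<alpha> where "\<alpha> k = (if even k then (x \<circ> s) (k div 2) else (y \<circ> s) (k div 2))" for k
  have "lac_stat_quasi_Cauchy \<theta> \<alpha>"
    unfolding \<alpha>_def
    by (rule convergent_imp_lac_stat_quasi_Cauchy[OF assms(1) interleave_tendsto[OF lim_x lim_y]])
  moreover have "\<alpha> k \<in> E" for k
    using xE yE by (simp add: \<alpha>_def)
  ultimately have "lac_stat_convergent \<theta> (\<lambda>k. f (\<alpha> (k + 1)) - f (\<alpha> k)) 0"
    using assms(4) by (simp add: lac_stat_ward_continuous_on_def lac_stat_quasi_Cauchy_def)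
  moreover
  \<comment> \<open>For even \<open>k\<close>, \<open>k\<close> and \<open>k + 1\<close> have the
    same half, so this step goes from an \<open>x\<close> to its partner \<open>y\<close>.\<close>
  have "\<bar>f (\<alpha> (k + 1)) - f (\<alpha> k) - 0\<bar> \<ge> e" if "even k" for k
    using that apart[of "s (k div 2)"] by (simp add: \<alpha>_def abs_minus_commute)
  then have "\<not> lac_stat_convergent \<theta> (\<lambda>k. f (\<alpha> (k + 1)) - f (\<alpha> k)) 0"
    by (rule not_lac_stat_convergent_if_even_far[OF assms(1) \<open>e > 0\<close>])
  ultimately show False
    by contradiction
qed

end
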